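(* Let $N\ge 2$ and let $\mathbb{S}^N\subset\mathbb{R}^{N+1}$ be the unit hypersphere centered at the origin. Every minimal submanifold $\Sigma^n$ ($n\ge1$) of $\mathbb{S}^N$, regarded as a submanifold of $\mathbb{R}^{N+1}$, is an expander for the inverse mean curvature flow.
   Context: For a smooth submanifold $\Sigma^n\subset\mathbb{R}^M$ with position vector $X$ and induced metric $g$, the mean curvature vector is $\overrightarrow{H}=\triangle_g X$ (the trace of the second fundamental form). A submanifold $\Sigma^n\subset\mathbb{R}^M$ with nowhere vanishing mean curvature vector is called a homothetic soliton for the inverse mean curvature flow if there is a constant $C\in\mathbb{R}\setminus\{0\}$ such that \[ -\frac{1}{|\overrightarrow{H}|^2}\overrightarrow{H}=C\,X^{\perp}\quad\text{on }\Sigma, \] where $X^\perp$ is the normal component of $X$. It is called an expander if this holds with some $C>0$. *)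

theory Defs
  imports "HOL-Analysis.Analysis"
begin

section \<open>Calculus in local coordinates\<close>

definition pd :: "'n::finite \<Rightarrow> (real^'n \<Rightarrow> 'b::real_normed_vector) \<Rightarrow> real^'n \<Rightarrow> 'b" where
  "pd i f x = frechet_derivative f (at x) (axis i 1)"

text \<open>\<open>C\<^sup>\<infinity>\<close> on an open set: every iterated partial derivative is (Frechet) differentiable there.\<close>

definition smooth_on :: "(real^'n::finite) set \<Rightarrow> (real^'n \<Rightarrow> 'b::real_normed_vector) \<Rightarrow> bool" where
  "smooth_on U f \<longleftrightarrow> (\<forall>is. foldr pd is f differentiable_on U)"


section \<open>Submanifolds of Euclidean space\<close>

text \<open>
  A submanifold is an abstract space \<open>M\<close> together with its position vector \<open>X\<close>, a smooth
  immersion into Euclidean space. The smooth structure is the one making \<open>X\<close> an immersion, so it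
  is determined by the topology of \<open>M\<close> and by \<open>X\<close>, and transition maps between local
  parametrizations are automatically smooth. An embedded submanifold \<open>S\<close> is the case in which
  \<open>M\<close> is \<open>top_of_set S\<close> and \<open>X\<close> is the identity.
\<close>

definition local_parametrization ::
  "'p topology \<Rightarrow> ('p \<Rightarrow> real^'m::finite) \<Rightarrow> (real^'n::finite) set \<Rightarrow> (real^'n \<Rightarrow> 'p) \<Rightarrow> bool" where
  "local_parametrization M X U \<psi> \<longleftrightarrow>
     open U \<and> openin M (\<psi> ` U) \<and>
     homeomorphic_map (top_of_set U) (subtopology M (\<psi> ` U)) \<psi> \<and>
     smooth_on U (X \<circ> \<psi>) \<and>
     (\<forall>x\<in>U. inj (frechet_derivative (X \<circ> \<psi>) (at x)))"

text \<open>The type argument fixes the dimension \<open>n = CARD('n) \<ge> 1\<close>.\<close>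

definition submanifold ::
  "'n::finite itself \<Rightarrow> 'p topology \<Rightarrow> ('p \<Rightarrow> real^'m::finite) \<Rightarrow> bool" where
  "submanifold TYPE('n) M X \<longleftrightarrow>
     Hausdorff_space M \<and> second_countable M \<and>
     (\<forall>p\<in>topspace M. \<exists>(U :: (real^'n) set) \<psi>. local_parametrization M X U \<psi> \<and> p \<in> \<psi> ` U)"


section \<open>Laplacian and mean curvature vector\<close>

text \<open>From here on \<open>\<phi>\<close> stands for a position vector in local coordinates, \<open>\<phi> = X \<circ> \<psi>\<close>.\<close>

definition induced_metric ::
  "(real^'n::finite \<Rightarrow> real^'m::finite) \<Rightarrow> real^'n \<Rightarrow> real^'n^'n" where
  "induced_metric \<phi> x = (\<chi> i j. pd i \<phi> x \<bullet> pd j \<phi> x)"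

text \<open>\<open>christoffel g k i j x\<close> is \<open>\<Gamma>\<^sup>k\<^sub>i\<^sub>j\<close> at \<open>x\<close>.\<close>

definition christoffel ::
  "(real^'n::finite \<Rightarrow> real^'n^'n) \<Rightarrow> 'n \<Rightarrow> 'n \<Rightarrow> 'n \<Rightarrow> real^'n \<Rightarrow> real" where
  "christoffel g k i j x =
     (\<Sum>l\<in>UNIV. matrix_inv (g x) $ k $ l *
        (pd i (\<lambda>y. g y $ j $ l) x + pd j (\<lambda>y. g y $ i $ l) x - pd l (\<lambda>y. g y $ i $ j) x)) / 2"

text \<open>The Laplace-Beltrami operator as the metric trace of the Hessian of the Levi-Civita
  connection; on vector-valued functions it acts componentwise.\<close>

definition laplace_beltrami ::
  "(real^'n::finite \<Rightarrow> real^'n^'n) \<Rightarrow> (real^'n \<Rightarrow> 'b::real_normed_vector) \<Rightarrow> real^'n \<Rightarrow> 'b" where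
  "laplace_beltrami g f x =
     (\<Sum>i\<in>UNIV. \<Sum>j\<in>UNIV. matrix_inv (g x) $ i $ j *\<^sub>R
        (pd i (pd j f) x - (\<Sum>k\<in>UNIV. christoffel g k i j x *\<^sub>R pd k f x)))"

definition mean_curvature_vector ::
  "(real^'n::finite \<Rightarrow> real^'m::finite) \<Rightarrow> real^'n \<Rightarrow> real^'m" where
  "mean_curvature_vector \<phi> x = laplace_beltrami (induced_metric \<phi>) \<phi> x"


section \<open>Tangential and normal components\<close>

definition orth_proj :: "'a::euclidean_space set \<Rightarrow> 'a \<Rightarrow> 'a" where
  "orth_proj V v = (THE u. u \<in> V \<and> (\<forall>w\<in>V. orthogonal (v - u) w))"

definition tangent_space ::
  "(real^'n::finite \<Rightarrow> real^'m::finite) \<Rightarrow> real^'n \<Rightarrow> (real^'m) set" where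
  "tangent_space \<phi> x = span (range (\<lambda>i. pd i \<phi> x))"

definition normal_component ::
  "(real^'n::finite \<Rightarrow> real^'m::finite) \<Rightarrow> real^'n \<Rightarrow> real^'m \<Rightarrow> real^'m" where
  "normal_component \<phi> x v = v - orth_proj (tangent_space \<phi> x) v"


section \<open>Minimal submanifolds of the unit sphere\<close>

definition sphere_tangent_space :: "real^'m::finite \<Rightarrow> (real^'m) set" where
  "sphere_tangent_space p = {v. orthogonal p v}"

text \<open>Covariant derivative of the coordinate field \<open>\<partial>\<^sub>j \<phi>\<close> in direction \<open>\<partial>\<^sub>i \<phi>\<close> for the Levi-Civita
  connection of the unit sphere, i.e. the sphere-tangential part of the Euclidean derivative.\<close>

definition sphere_covariant_derivative ::
  "(real^'n::finite \<Rightarrow> real^'m::finite) \<Rightarrow> 'n \<Rightarrow> 'n \<Rightarrow> real^'n \<Rightarrow> real^'m" where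
  "sphere_covariant_derivative \<phi> i j x =
     orth_proj (sphere_tangent_space (\<phi> x)) (pd i (pd j \<phi>) x)"

definition sphere_second_fundamental_form ::
  "(real^'n::finite \<Rightarrow> real^'m::finite) \<Rightarrow> 'n \<Rightarrow> 'n \<Rightarrow> real^'n \<Rightarrow> real^'m" where
  "sphere_second_fundamental_form \<phi> i j x =
     normal_component \<phi> x (sphere_covariant_derivative \<phi> i j x)"

definition sphere_mean_curvature_vector ::
  "(real^'n::finite \<Rightarrow> real^'m::finite) \<Rightarrow> real^'n \<Rightarrow> real^'m" where
  "sphere_mean_curvature_vector \<phi> x =
     (\<Sum>i\<in>UNIV. \<Sum>j\<in>UNIV. matrix_inv (induced_metric \<phi> x) $ i $ j *\<^sub>R
        sphere_second_fundamental_form \<phi> i j x)"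

text \<open>The curvature vectors do not depend on the chosen coordinates; below, equations on the
  submanifold are required in every local parametrization.\<close>

definition minimal_in_unit_sphere ::
  "'n::finite itself \<Rightarrow> 'p topology \<Rightarrow> ('p \<Rightarrow> real^'m::finite) \<Rightarrow> bool" where
  "minimal_in_unit_sphere TYPE('n) M X \<longleftrightarrow>
     submanifold TYPE('n) M X \<and> X ` topspace M \<subseteq> sphere 0 1 \<and>
     (\<forall>(U :: (real^'n) set) \<psi>. local_parametrization M X U \<psi> \<longrightarrow>
        (\<forall>x\<in>U. sphere_mean_curvature_vector (X \<circ> \<psi>) x = 0))"


section \<open>Homothetic solitons for the inverse mean curvature flow\<close>

definition imcf_homothetic_soliton ::
  "'n::finite itself \<Rightarrow> real \<Rightarrow> 'p topology \<Rightarrow> ('p \<Rightarrow> real^'m::finite) \<Rightarrow> bool" where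
  "imcf_homothetic_soliton TYPE('n) C M X \<longleftrightarrow>
     submanifold TYPE('n) M X \<and> C \<noteq> 0 \<and>
     (\<forall>(U :: (real^'n) set) \<psi>. local_parametrization M X U \<psi> \<longrightarrow>
        (\<forall>x\<in>U.
           mean_curvature_vector (X \<circ> \<psi>) x \<noteq> 0 \<and>
           - (1 / (norm (mean_curvature_vector (X \<circ> \<psi>) x))\<^sup>2) *\<^sub>R mean_curvature_vector (X \<circ> \<psi>) x
             = C *\<^sub>R normal_component (X \<circ> \<psi>) x (X (\<psi> x))))"

definition imcf_expander ::
  "'n::finite itself \<Rightarrow> 'p topology \<Rightarrow> ('p \<Rightarrow> real^'m::finite) \<Rightarrow> bool" where
  "imcf_expander TYPE('n) M X \<longleftrightarrow> (\<exists>C>0. imcf_homothetic_soliton TYPE('n) C M X)"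

end

theory Submission
  imports Defs
begin

text \<open>
  In local coordinates \<open>\<phi>\<close>, differentiating \<open>\<phi> \<bullet> \<phi> = 1\<close> twice shows that \<open>\<phi>\<close> is normal and
  \<open>\<phi> \<bullet> \<partial>\<^sub>i \<partial>\<^sub>j \<phi> = - g\<^sub>i\<^sub>j\<close>. Hence the second fundamental form in the sphere is that in Euclidean space
  plus \<open>g\<^sub>i\<^sub>j \<phi>\<close>, and taking the trace, minimality says that the normal part of \<open>g\<^sup>i\<^sup>j \<partial>\<^sub>i \<partial>\<^sub>j \<phi>\<close>
  is \<open>- n \<phi>\<close>. By the Koszul formula the Hessian of \<open>\<phi>\<close> is normal, so this normal part is the mean
  curvature vector, and the soliton equation holds with \<open>C = 1 / n\<close>.
\<close>

section \<open>Symmetry of second derivatives\<close>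

text \<open>The second difference is an increment over [0, t] of the first difference in direction
  \<open>v\<close>, moved along \<open>u\<close>. The mean value inequality bounds it, since
  differentiability of \<open>\<lambda>y. f' y u\<close> at \<open>x\<close> controls the derivative
  of that first difference.\<close>

lemma second_difference_bound:
  fixes f :: "'a::real_normed_vector \<Rightarrow> 'b::real_normed_vector"
  assumes "open U" "x \<in> U"
    and f': "\<And>y. y \<in> U \<Longrightarrow> (f has_derivative f' y) (at y)"
    and F: "((\<lambda>y. f' y u) has_derivative F) (at x)"
    and "e > 0"
  shows "\<forall>\<^sub>F t in at_right 0.
    norm (f (x + t *\<^sub>R u + t *\<^sub>R v) - f (x + t *\<^sub>R u) - f (x + t *\<^sub>R v) + f x - t\<^sup>2 *\<^sub>R F v) \<le> e * t\<^sup>2"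
proof -
  \<comment> \<open>All points used are \<open>x + s u + r v\<close> with s, r in [0, t], hence
    within \<open>t * K\<close> of \<open>x\<close>; the summand 1 keeps \<open>K\<close> positive
    even if \<open>u\<close> and \<open>v\<close> vanish.\<close>
  define K where "K = norm u + norm v + 1"
  have K: "K > 0" unfolding K_def by (simp add: add_nonneg_pos)
  \<comment> \<open>Two approximation errors of size \<open>e' * (t * K)\<close>, over an interval
    of length \<open>t\<close>, then add up to \<open>e * t\<^sup>2\<close>.\<close>
  define e' where "e' = e / (2 * K)"
  have e': "e' > 0" using \<open>e > 0\<close> K by (simp add: e'_def)
  obtain d1 where d1: "d1 > 0" "ball x d1 \<subseteq> U"
    using \<open>open U\<close> \<open>x \<in> U\<close> openE by blast
  obtain d2 where d2: "d2 > 0"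
    "\<And>y. norm (y - x) < d2 \<Longrightarrow> norm (f' y u - f' x u - F (y - x)) \<le> e' * norm (y - x)"
    using F e' unfolding has_derivative_at_alt by blast
  interpret F: bounded_linear F using F by (rule has_derivative_bounded_linear)
  define d where "d = min d1 d2 / K"
  have "d > 0" using d1 d2 K by (simp add: d_def)
  have "norm (f (x + t *\<^sub>R u + t *\<^sub>R v) - f (x + t *\<^sub>R u) - f (x + t *\<^sub>R v) + f x - t\<^sup>2 *\<^sub>R F v) \<le> e * t\<^sup>2"
    if t: "0 < t" "t < d" for t
  proof -
    have tK: "t * K < min d1 d2" using t K by (simp add: d_def field_simps)
    have small: "norm (s *\<^sub>R u + r *\<^sub>R v) \<le> t * K" if "0 \<le> s" "s \<le> t" "0 \<le> r" "r \<le> t" for s r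
    proof -
      have "norm (s *\<^sub>R u + r *\<^sub>R v) \<le> s * norm u + r * norm v"
        using norm_triangle_ineq[of "s *\<^sub>R u" "r *\<^sub>R v"] that by simp
      also have "\<dots> \<le> t * norm u + t * norm v"
        using that by (intro add_mono mult_right_mono) auto
      also have "\<dots> \<le> t * K" using t by (simp add: K_def algebra_simps)
      finally show ?thesis .
    qed
    have inU: "x + s *\<^sub>R u + r *\<^sub>R v \<in> U" if "0 \<le> s" "s \<le> t" "0 \<le> r" "r \<le> t" for s r
    proof -
      have "dist x (x + s *\<^sub>R u + r *\<^sub>R v) = norm (s *\<^sub>R u + r *\<^sub>R v)"
        by (simp add: dist_norm norm_minus_commute algebra_simps flip: norm_minus_cancel[of "s *\<^sub>R u + r *\<^sub>R v"])
      then show ?thesis using small[OF that] tK d1 by (auto simp: subset_iff)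
    qed
    have approx: "norm (f' (x + s *\<^sub>R u + r *\<^sub>R v) u - f' x u - F (s *\<^sub>R u + r *\<^sub>R v)) \<le> e' * (t * K)"
      if "0 \<le> s" "s \<le> t" "0 \<le> r" "r \<le> t" for s r
    proof -
      have "norm (f' (x + s *\<^sub>R u + r *\<^sub>R v) u - f' x u - F (s *\<^sub>R u + r *\<^sub>R v)) \<le> e' * norm (s *\<^sub>R u + r *\<^sub>R v)"
        using d2(2)[of "x + s *\<^sub>R u + r *\<^sub>R v"] small[OF that] tK by (simp add: add.assoc)
      also have "\<dots> \<le> e' * (t * K)" using small[OF that] e' by simp
      finally show ?thesis .
    qed
    \<comment> \<open>\<open>h t - h 0\<close> is the second difference minus
      \<open>t\<^sup>2 *\<^sub>R F v\<close>. The vacuous \<open>0 *\<^sub>R v\<close> makes both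
      terms instances of the same pattern, with r = t and r = 0, so that \<open>der\<close> and
      \<open>approx\<close> apply to each.\<close>
    define h where "h s = f (x + s *\<^sub>R u + t *\<^sub>R v) - f (x + s *\<^sub>R u + 0 *\<^sub>R v) - s *\<^sub>R t *\<^sub>R F v" for s
    define h' where "h' s = f' (x + s *\<^sub>R u + t *\<^sub>R v) u - f' (x + s *\<^sub>R u + 0 *\<^sub>R v) u - t *\<^sub>R F v" for s
    have der: "((\<lambda>s. f (x + s *\<^sub>R u + r *\<^sub>R v)) has_derivative (\<lambda>k. k *\<^sub>R f' (x + s *\<^sub>R u + r *\<^sub>R v) u)) (at s within {0..t})"
      if "s \<in> {0..t}" "0 \<le> r" "r \<le> t" for s r
    proof -
      have D: "(f has_derivative f' (x + s *\<^sub>R u + r *\<^sub>R v)) (at (x + s *\<^sub>R u + r *\<^sub>R v))"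
        using that by (intro f' inU) auto
      have "((\<lambda>s. f (x + s *\<^sub>R u + r *\<^sub>R v)) has_derivative (\<lambda>k. f' (x + s *\<^sub>R u + r *\<^sub>R v) (k *\<^sub>R u))) (at s within {0..t})"
        by (rule has_derivative_compose[where f = "\<lambda>s. x + s *\<^sub>R u + r *\<^sub>R v" and g = f, OF _ D]) (use that in \<open>auto intro!: derivative_eq_intros\<close>)
      then show ?thesis
        using linear_cmul[OF has_derivative_linear[OF D]] that by simp
    qed
    have "norm (h t - h 0) \<le> (2 * (e' * (t * K))) * norm (t - 0)"
    proof (rule differentiable_bound)
      show "(h has_derivative (\<lambda>k. k *\<^sub>R h' s)) (at s within {0..t})" if "s \<in> {0..t}" for s
        unfolding h_def h'_def scaleR_diff_right
        by (rule has_derivative_diff[OF has_derivative_diff[OF der der] has_derivative_scaleR_left[OF has_derivative_ident]])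
            (use that t in auto)
      show "onorm (\<lambda>k. k *\<^sub>R h' s) \<le> 2 * (e' * (t * K))" if s: "s \<in> {0..t}" for s
      proof (rule onorm_bound)
        \<comment> \<open>Both values of \<open>f'\<close> are compared with the expansion at
          \<open>x\<close>; by linearity the two values of \<open>F\<close> differ by exactly
          \<open>t *\<^sub>R F v\<close>.\<close>
        have "h' s = (f' (x + s *\<^sub>R u + t *\<^sub>R v) u - f' x u - F (s *\<^sub>R u + t *\<^sub>R v))
              - (f' (x + s *\<^sub>R u + 0 *\<^sub>R v) u - f' x u - F (s *\<^sub>R u + 0 *\<^sub>R v))"
          by (simp add: h'_def F.add F.scaleR)
        also have "norm \<dots> \<le> e' * (t * K) + e' * (t * K)"
          using s t by (intro order.trans[OF norm_triangle_ineq4] add_mono approx) auto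
        finally have "norm (h' s) \<le> 2 * (e' * (t * K))" unfolding mult_2 .
        then show "norm (k *\<^sub>R h' s) \<le> 2 * (e' * (t * K)) * norm k" for k
          unfolding norm_scaleR real_norm_def mult.commute[of "\<bar>k\<bar>"] by (rule mult_right_mono) simp
      qed (use e' t K in auto)
    qed (use t in auto)
    also have "\<dots> = e * t\<^sup>2" using t K by (simp add: e'_def power2_eq_square)
    also have "h t - h 0 = f (x + t *\<^sub>R u + t *\<^sub>R v) - f (x + t *\<^sub>R u) - f (x + t *\<^sub>R v) + f x - t\<^sup>2 *\<^sub>R F v"
      by (simp add: h_def power2_eq_square)
    finally show ?thesis .
  qed
  then show ?thesis
    using \<open>d > 0\<close> by (auto simp: eventually_at_right_field)
qed

text \<open>The second difference is symmetric in \<open>u\<close> and \<open>v\<close>, and both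
  \<open>t\<^sup>2 *\<^sub>R F v\<close> and \<open>t\<^sup>2 *\<^sub>R G u\<close> approximate it
  up to \<open>e * t\<^sup>2\<close>. Division by \<open>t\<^sup>2\<close> leaves a bound that is
  independent of t.\<close>

lemma second_derivative_symmetric:
  fixes f :: "'a::real_normed_vector \<Rightarrow> 'b::real_normed_vector"
  assumes "open U" "x \<in> U"
    and "\<And>y. y \<in> U \<Longrightarrow> (f has_derivative f' y) (at y)"
    and "((\<lambda>y. f' y u) has_derivative F) (at x)"
    and "((\<lambda>y. f' y v) has_derivative G) (at x)"
  shows "F v = G u"
proof -
  have "norm (F v - G u) \<le> 2 * e" if "e > 0" for e
  proof -
    have F: "\<forall>\<^sub>F t in at_right 0.
      norm (f (x + t *\<^sub>R u + t *\<^sub>R v) - f (x + t *\<^sub>R u) - f (x + t *\<^sub>R v) + f x - t\<^sup>2 *\<^sub>R F v) \<le> e * t\<^sup>2"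
      by (rule second_difference_bound[where f' = f', OF assms(1,2)]) (use assms that in auto)
    have G: "\<forall>\<^sub>F t in at_right 0.
      norm (f (x + t *\<^sub>R v + t *\<^sub>R u) - f (x + t *\<^sub>R v) - f (x + t *\<^sub>R u) + f x - t\<^sup>2 *\<^sub>R G u) \<le> e * t\<^sup>2"
      by (rule second_difference_bound[where f' = f', OF assms(1,2)]) (use assms that in auto)
    have "\<forall>\<^sub>F t in at_right (0::real). norm (F v - G u) \<le> 2 * e"
      using F G eventually_at_right_less[of 0]
    proof eventually_elim
      case (elim t)
      define D where "D = f (x + t *\<^sub>R u + t *\<^sub>R v) - f (x + t *\<^sub>R u) - f (x + t *\<^sub>R v) + f x"
      have D': "f (x + t *\<^sub>R v + t *\<^sub>R u) - f (x + t *\<^sub>R v) - f (x + t *\<^sub>R u) + f x = D"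
        by (simp add: D_def algebra_simps)
      have "t\<^sup>2 * norm (F v - G u) = norm ((D - t\<^sup>2 *\<^sub>R G u) - (D - t\<^sup>2 *\<^sub>R F v))"
        by (simp flip: scaleR_diff_right)
      also have "\<dots> \<le> e * t\<^sup>2 + e * t\<^sup>2"
        using elim(1,2) unfolding D' D_def[symmetric]
        by (intro order.trans[OF norm_triangle_ineq4]) auto
      also have "\<dots> = t\<^sup>2 * (2 * e)" by simp
      finally have "t\<^sup>2 * norm (F v - G u) \<le> t\<^sup>2 * (2 * e)" .
      then show ?case using elim(3) by simp
    qed
    \<comment> \<open>The bound does not mention t, and the filter \<open>at_right 0\<close> is
      nontrivial.\<close>
    then show ?thesis by simp
  qed
  from this[of "e / 2" for e] have "norm (F v - G u) \<le> 0"
    by - (rule field_le_epsilon, simp)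
  then show ?thesis by simp
qed


section \<open>Partial derivatives\<close>

lemma has_derivative_imp_pd: "(f has_derivative f') (at x) \<Longrightarrow> pd i f x = f' (axis i 1)"
  by (metis frechet_derivative_at pd_def)

lemma pd_inner:
  fixes f g :: "real^'n::finite \<Rightarrow> 'b::real_inner"
  assumes "f differentiable (at x)" "g differentiable (at x)"
  shows "pd i (\<lambda>y. f y \<bullet> g y) x = pd i f x \<bullet> g x + f x \<bullet> pd i g x"
  using has_derivative_inner[OF frechet_derivative_works[THEN iffD1, OF assms(1)] frechet_derivative_works[THEN iffD1, OF assms(2)]]
  by (simp add: has_derivative_imp_pd) (simp add: pd_def)

text \<open>Needed to differentiate identities that hold only on the chart domain.
  \<open>frechet_derivative\<close> is chosen from the relation \<open>has_derivative\<close>, so it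
  suffices that both functions have the same derivatives at \<open>x\<close>.\<close>

lemma pd_cong_open:
  assumes "open U" "x \<in> U" "\<And>y. y \<in> U \<Longrightarrow> f y = g y"
  shows "pd i f x = pd i g x"
proof -
  have "(f has_derivative f') (at x) \<longleftrightarrow> (g has_derivative f') (at x)" for f'
    using assms by (metis has_derivative_transform_within_open)
  then show ?thesis by (simp add: pd_def frechet_derivative_def)
qed

lemma pd_const [simp]: "pd i (\<lambda>_. c) x = 0"
  by (simp add: pd_def)

lemma frechet_derivative_eq_sum_pd:
  assumes "f differentiable (at x)"
  shows "frechet_derivative f (at x) v = (\<Sum>i\<in>UNIV. v $ i *\<^sub>R pd i f x)"
proof -
  have lin: "linear (frechet_derivative f (at x))"
    using assms by (rule linear_frechet_derivative)
  have "frechet_derivative f (at x) v = frechet_derivative f (at x) (\<Sum>i\<in>UNIV. v $ i *\<^sub>R axis i 1)"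
    by (simp add: basis_expansion flip: scalar_mult_eq_scaleR)
  then show ?thesis
    by (simp add: linear_sum[OF lin] linear_cmul[OF lin] pd_def)
qed


section \<open>Orthogonal projections\<close>

text \<open>The difference of two candidates lies in \<open>V\<close> and is orthogonal to
  \<open>V\<close>, hence to itself, so the definite description has a unique solution.\<close>

lemma orth_proj_eqI:
  assumes "subspace V" "u \<in> V" "\<And>w. w \<in> V \<Longrightarrow> orthogonal (v - u) w"
  shows "orth_proj V v = u"
  unfolding orth_proj_def
proof (rule the_equality)
  fix u' assume u': "u' \<in> V \<and> (\<forall>w\<in>V. orthogonal (v - u') w)"
  then have "u' - u \<in> V" using assms by (simp add: subspace_diff)
  then have "orthogonal ((v - u) - (v - u')) (u' - u)"
    using assms(3) u' by (metis orthogonal_clauses(10))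
  then show "u' = u" by (simp add: orthogonal_def)
qed (use assms in auto)

text \<open>Orthogonality to the coordinate fields extends to their span, so normality need only be
  tested on generators.\<close>

lemma normal_component_eqI:
  assumes "v - w \<in> tangent_space \<phi> x" "\<And>i. w \<bullet> pd i \<phi> x = 0"
  shows "normal_component \<phi> x v = w"
proof -
  have "orthogonal w y" if "y \<in> tangent_space \<phi> x" for y
    using that unfolding tangent_space_def
    by (rule orthogonal_to_span) (use assms in \<open>auto simp: orthogonal_def\<close>)
  then have "orth_proj (tangent_space \<phi> x) v = v - w"
    using assms(1) by (intro orth_proj_eqI) (auto simp: tangent_space_def)
  then show ?thesis by (simp add: normal_component_def)
qed

text \<open>The orthogonal decomposition along the span supplies the existence that the definite
  description in \<open>orth_proj\<close> requires.\<close>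

lemma normal_component_props:
  shows "v - normal_component \<phi> x v \<in> tangent_space \<phi> x"
    and "normal_component \<phi> x v \<bullet> pd i \<phi> x = 0"
proof -
  obtain y z where yz: "y \<in> tangent_space \<phi> x"
    "\<And>w. w \<in> tangent_space \<phi> x \<Longrightarrow> orthogonal z w" "v = y + z"
    using orthogonal_subspace_decomp_exists[of "range (\<lambda>i. pd i \<phi> x)" v]
    unfolding tangent_space_def by metis
  have z: "z \<bullet> pd i \<phi> x = 0" for i
    using yz(2)[of "pd i \<phi> x"] by (auto simp: tangent_space_def span_base orthogonal_def)
  then have "normal_component \<phi> x v = z"
    using yz by (intro normal_component_eqI) auto
  then show "v - normal_component \<phi> x v \<in> tangent_space \<phi> x"
    and "normal_component \<phi> x v \<bullet> pd i \<phi> x = 0"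
    using yz z by auto
qed

lemma linear_normal_component: "linear (normal_component \<phi> x)"
proof
  have sub: "subspace (tangent_space \<phi> x)" by (simp add: tangent_space_def)
  show "normal_component \<phi> x (v + w) = normal_component \<phi> x v + normal_component \<phi> x w" for v w
  proof (rule normal_component_eqI)
    have "v + w - (normal_component \<phi> x v + normal_component \<phi> x w) =
      (v - normal_component \<phi> x v) + (w - normal_component \<phi> x w)" by simp
    then show "v + w - (normal_component \<phi> x v + normal_component \<phi> x w) \<in> tangent_space \<phi> x"
      using sub by (metis normal_component_props(1) subspace_add)
  qed (simp add: inner_add_left normal_component_props)
  show "normal_component \<phi> x (c *\<^sub>R v) = c *\<^sub>R normal_component \<phi> x v" for c v
    by (rule normal_component_eqI)
      (use sub in \<open>simp_all add: normal_component_props subspace_scale flip: scaleR_diff_right\<close>)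
qed

lemma orth_proj_sphere_tangent_space:
  assumes "norm p = 1"
  shows "orth_proj (sphere_tangent_space p) v = v - (p \<bullet> v) *\<^sub>R p"
proof (rule orth_proj_eqI)
  have "p \<bullet> p = 1" using assms by (simp add: dot_square_norm)
  then show "v - (p \<bullet> v) *\<^sub>R p \<in> sphere_tangent_space p"
    by (simp add: sphere_tangent_space_def orthogonal_def inner_diff_right)
qed (auto simp: sphere_tangent_space_def orthogonal_def subspace_def inner_add_right)


section \<open>Immersions in local coordinates\<close>

text \<open>A single chart with the topology of the submanifold forgotten, since the curvature
  computations are local; it is used with \<open>\<phi> = X \<circ> \<psi>\<close>.\<close>

locale coordinate_immersion =
  fixes U :: "(real^'n::finite) set" and \<phi> :: "real^'n \<Rightarrow> real^'m::finite"
  assumes open_U: "open U"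
    and smooth: "smooth_on U \<phi>"
    and inj_derivative: "x \<in> U \<Longrightarrow> inj (frechet_derivative \<phi> (at x))"
begin

lemma differentiable_immersion: "x \<in> U \<Longrightarrow> \<phi> differentiable (at x)"
  using smooth[unfolded smooth_on_def, rule_format, of "[]"] open_U
  by (simp add: differentiable_on_eq_differentiable_at)

lemma differentiable_pd: "x \<in> U \<Longrightarrow> pd i \<phi> differentiable (at x)"
  using smooth[unfolded smooth_on_def, rule_format, of "[i]"] open_U
  by (simp add: differentiable_on_eq_differentiable_at)

lemma pd_commute:
  assumes "x \<in> U"
  shows "pd i (pd j \<phi>) x = pd j (pd i \<phi>) x"
  unfolding pd_def[of i "pd j \<phi>"] pd_def[of j "pd i \<phi>"]
proof (rule second_derivative_symmetric[OF open_U assms])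
  show "(\<phi> has_derivative frechet_derivative \<phi> (at y)) (at y)" if "y \<in> U" for y
    using differentiable_immersion[OF that] by (simp add: frechet_derivative_works)
  have "((\<lambda>y. pd i \<phi> y) has_derivative frechet_derivative (pd i \<phi>) (at x)) (at x)" for i
    using differentiable_pd[OF assms] by (simp add: frechet_derivative_works)
  then show "((\<lambda>y. frechet_derivative \<phi> (at y) (axis j 1)) has_derivative frechet_derivative (pd j \<phi>) (at x)) (at x)"
    "((\<lambda>y. frechet_derivative \<phi> (at y) (axis i 1)) has_derivative frechet_derivative (pd i \<phi>) (at x)) (at x)"
    by (simp_all add: pd_def)
qed

text \<open>The quadratic form of the Gram matrix at v is the squared norm of the derivative of
  \<open>\<phi>\<close> applied to v. Injectivity of the derivative therefore makes the kernel
  trivial, and \<open>matrix_inv\<close> is a genuine two-sided inverse.\<close>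

lemma induced_metric_inverse:
  assumes "x \<in> U"
  shows "induced_metric \<phi> x ** matrix_inv (induced_metric \<phi> x) = mat 1"
    and "matrix_inv (induced_metric \<phi> x) ** induced_metric \<phi> x = mat 1"
proof -
  let ?g = "induced_metric \<phi> x"
  note der = frechet_derivative_eq_sum_pd[OF differentiable_immersion[OF assms]]
  have "v = 0" if "?g *v v = 0" for v
  proof -
    have "frechet_derivative \<phi> (at x) v \<bullet> frechet_derivative \<phi> (at x) v = v \<bullet> (?g *v v)"
      unfolding der
      by (simp add: inner_commute inner_sum_left inner_sum_right inner_vec_def[of v] induced_metric_def
          matrix_vector_mult_def sum_distrib_left inner_commute mult_ac)
    then have "frechet_derivative \<phi> (at x) v = frechet_derivative \<phi> (at x) 0"
      using that by (simp add: der)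
    then show ?thesis using inj_derivative[OF assms] by (simp add: inj_eq)
  qed
  then have "\<exists>B. B ** ?g = mat 1" by (simp add: matrix_left_invertible_ker)
  then have "\<exists>B. ?g ** B = mat 1 \<and> B ** ?g = mat 1" by (metis matrix_left_right_inverse)
  then have "?g ** matrix_inv ?g = mat 1 \<and> matrix_inv ?g ** ?g = mat 1"
    unfolding matrix_inv_def by (rule someI_ex)
  then show "?g ** matrix_inv ?g = mat 1" "matrix_inv ?g ** ?g = mat 1" by auto
qed

text \<open>By symmetry of the metric the double sum is the trace of the product of the inverse
  metric with the metric, that is, of the identity matrix.\<close>

lemma trace_metric:
  assumes "x \<in> U"
  shows "(\<Sum>i\<in>UNIV. \<Sum>j\<in>UNIV. matrix_inv (induced_metric \<phi> x) $ i $ j * (pd i \<phi> x \<bullet> pd j \<phi> x)) = CARD('n)"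
proof -
  have "(\<Sum>j\<in>UNIV. matrix_inv (induced_metric \<phi> x) $ i $ j * (pd i \<phi> x \<bullet> pd j \<phi> x))
      = (matrix_inv (induced_metric \<phi> x) ** induced_metric \<phi> x) $ i $ i" for i
    by (simp add: matrix_matrix_mult_def induced_metric_def inner_commute)
  then show ?thesis by (simp add: induced_metric_inverse[OF assms] mat_def)
qed

text \<open>In the Koszul combination of metric derivatives the product rule gives six terms;
  commuting partial derivatives cancel four of them and identify the other two.\<close>

lemma christoffel_lower:
  assumes "x \<in> U"
  shows "(\<Sum>k\<in>UNIV. christoffel (induced_metric \<phi>) k i j x * (pd k \<phi> x \<bullet> pd l \<phi> x)) = pd i (pd j \<phi>) x \<bullet> pd l \<phi> x"
proof -
  let ?g = "induced_metric \<phi> x"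
  have koszul: "pd i (\<lambda>y. induced_metric \<phi> y $ j $ m) x + pd j (\<lambda>y. induced_metric \<phi> y $ i $ m) x
      - pd m (\<lambda>y. induced_metric \<phi> y $ i $ j) x = 2 * (pd i (pd j \<phi>) x \<bullet> pd m \<phi> x)" for m
    using pd_commute[OF assms, of j i] pd_commute[OF assms, of m i] pd_commute[OF assms, of m j]
    by (simp add: induced_metric_def pd_inner differentiable_pd[OF assms] inner_commute)
  \<comment> \<open>The Koszul factor 2 cancels the division by 2 in \<open>christoffel\<close>;
    reading the lowering factor as the entry (l, k) of the symmetric metric turns the sum over k
    into a matrix product.\<close>
  have "(\<Sum>k\<in>UNIV. christoffel (induced_metric \<phi>) k i j x * (pd k \<phi> x \<bullet> pd l \<phi> x))
      = (\<Sum>k\<in>UNIV. \<Sum>m\<in>UNIV. ?g $ l $ k * matrix_inv ?g $ k $ m * (pd i (pd j \<phi>) x \<bullet> pd m \<phi> x))"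
    unfolding christoffel_def koszul
    by (simp add: induced_metric_def inner_commute sum_distrib_left sum_distrib_right sum_divide_distrib mult_ac)
  also have "\<dots> = (\<Sum>m\<in>UNIV. (?g ** matrix_inv ?g) $ l $ m * (pd i (pd j \<phi>) x \<bullet> pd m \<phi> x))"
    by (subst sum.swap) (simp add: matrix_matrix_mult_def sum_distrib_right)
  also have "\<dots> = pd i (pd j \<phi>) x \<bullet> pd l \<phi> x"
    by (simp add: induced_metric_inverse[OF assms] mat_def if_distrib[of "\<lambda>c. c * _"] cong: if_cong)
  finally show ?thesis .
qed

text \<open>By \<open>christoffel_lower\<close> the Christoffel term is exactly the tangential part
  of each second derivative, so the identity holds entry by entry before the trace is taken.\<close>

lemma mean_curvature_vector_eq_normal_component:
  assumes "x \<in> U"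
  shows "mean_curvature_vector \<phi> x = (\<Sum>i\<in>UNIV. \<Sum>j\<in>UNIV.
    matrix_inv (induced_metric \<phi> x) $ i $ j *\<^sub>R normal_component \<phi> x (pd i (pd j \<phi>) x))"
proof -
  have "pd i (pd j \<phi>) x - (\<Sum>k\<in>UNIV. christoffel (induced_metric \<phi>) k i j x *\<^sub>R pd k \<phi> x)
      = normal_component \<phi> x (pd i (pd j \<phi>) x)" for i j
  proof (rule normal_component_eqI[symmetric])
    show "(pd i (pd j \<phi>) x - (\<Sum>k\<in>UNIV. christoffel (induced_metric \<phi>) k i j x *\<^sub>R pd k \<phi> x)) \<bullet> pd l \<phi> x = 0" for l
      by (simp add: inner_diff_left inner_sum_left christoffel_lower[OF assms])
    show "pd i (pd j \<phi>) x - (pd i (pd j \<phi>) x - (\<Sum>k\<in>UNIV. christoffel (induced_metric \<phi>) k i j x *\<^sub>R pd k \<phi> x)) \<in> tangent_space \<phi> x"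
      unfolding tangent_space_def diff_diff_eq2 add_diff_cancel_left'
      by (intro span_sum span_scale span_base rangeI)
  qed
  then show ?thesis
    by (simp add: mean_curvature_vector_def laplace_beltrami_def)
qed

end


section \<open>Immersions into the unit sphere\<close>

locale sphere_immersion = coordinate_immersion +
  assumes norm_immersion: "x \<in> U \<Longrightarrow> norm (\<phi> x) = 1"
begin

lemma immersion_orthogonal_pd:
  assumes "x \<in> U"
  shows "\<phi> x \<bullet> pd i \<phi> x = 0"
proof -
  have "pd i (\<lambda>y. \<phi> y \<bullet> \<phi> y) x = pd i (\<lambda>_. 1) x"
    by (rule pd_cong_open[OF open_U assms]) (simp add: dot_square_norm norm_immersion)
  then show ?thesis
    by (simp add: pd_inner differentiable_immersion[OF assms] inner_commute)
qed

lemma immersion_inner_pd_pd: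
  assumes "x \<in> U"
  shows "\<phi> x \<bullet> pd i (pd j \<phi>) x = - (pd i \<phi> x \<bullet> pd j \<phi> x)"
proof -
  have "pd i (\<lambda>y. \<phi> y \<bullet> pd j \<phi> y) x = pd i (\<lambda>_. 0) x"
    by (rule pd_cong_open[OF open_U assms]) (rule immersion_orthogonal_pd)
  then show ?thesis
    by (simp add: pd_inner differentiable_immersion[OF assms] differentiable_pd[OF assms])
qed

lemma normal_component_immersion: "x \<in> U \<Longrightarrow> normal_component \<phi> x (\<phi> x) = \<phi> x"
  by (rule normal_component_eqI) (auto simp: immersion_orthogonal_pd tangent_space_def span_zero)

text \<open>Projecting to the sphere subtracts the radial part, whose coefficient is minus the
  metric entry by \<open>immersion_inner_pd_pd\<close>. The radial vector is already normal, so
  \<open>normal_component\<close> leaves it unchanged.\<close>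

lemma sphere_second_fundamental_form_eq:
  assumes "x \<in> U"
  shows "sphere_second_fundamental_form \<phi> i j x =
    normal_component \<phi> x (pd i (pd j \<phi>) x) + (pd i \<phi> x \<bullet> pd j \<phi> x) *\<^sub>R \<phi> x"
  by (simp add: sphere_second_fundamental_form_def sphere_covariant_derivative_def
      orth_proj_sphere_tangent_space norm_immersion[OF assms] immersion_inner_pd_pd[OF assms]
      linear_add[OF linear_normal_component] linear_cmul[OF linear_normal_component]
      normal_component_immersion[OF assms])

text \<open>Here \<open>'a\<close> is the index type of the coordinates, so \<open>CARD('a)\<close>
  is the dimension of the submanifold; it arises as the trace of the metric term.\<close>

lemma sphere_mean_curvature_vector_eq:
  assumes "x \<in> U"
  shows "sphere_mean_curvature_vector \<phi> x = mean_curvature_vector \<phi> x + CARD('a) *\<^sub>R \<phi> x"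
  unfolding sphere_mean_curvature_vector_def mean_curvature_vector_eq_normal_component[OF assms]
    sphere_second_fundamental_form_eq[OF assms] trace_metric[OF assms, symmetric]
  by (simp add: scaleR_add_right sum.distrib scaleR_sum_left)

end

lemma local_parametrization_sphere_immersion:
  fixes X :: "'p \<Rightarrow> real^'m::finite" and U :: "(real^'n::finite) set"
  assumes "local_parametrization M X U \<psi>" "X ` topspace M \<subseteq> sphere 0 1"
  shows "sphere_immersion U (X \<circ> \<psi>)"
proof
  have "\<psi> ` U \<subseteq> topspace M"
    using assms(1) openin_subset unfolding local_parametrization_def by blast
  then show "norm ((X \<circ> \<psi>) x) = 1" if "x \<in> U" for x
    using assms(2) that by (auto simp: subset_iff image_iff)
qed (use assms(1) in \<open>auto simp: local_parametrization_def\<close>)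

theorem lemma13:
  fixes N :: nat and M :: "'p topology" and X :: "'p \<Rightarrow> real^'m::finite"
  assumes "N \<ge> 2" and "CARD('m) = N + 1"
    and "minimal_in_unit_sphere TYPE('n::finite) M X"
  shows "imcf_expander TYPE('n) M X"
proof -
  have sub: "submanifold TYPE('n) M X" and sph: "X ` topspace M \<subseteq> sphere 0 1"
    and min: "\<And>(U :: (real^'n) set) \<psi> x. local_parametrization M X U \<psi> \<Longrightarrow> x \<in> U \<Longrightarrow>
      sphere_mean_curvature_vector (X \<circ> \<psi>) x = 0"
    using assms(3) by (auto simp: minimal_in_unit_sphere_def)
  let ?n = "real CARD('n)"
  have "mean_curvature_vector (X \<circ> \<psi>) x \<noteq> 0 \<and>
      - (1 / (norm (mean_curvature_vector (X \<circ> \<psi>) x))\<^sup>2) *\<^sub>R mean_curvature_vector (X \<circ> \<psi>) x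
        = (1 / ?n) *\<^sub>R normal_component (X \<circ> \<psi>) x (X (\<psi> x))"
    if "local_parametrization M X U \<psi>" "x \<in> U" for U :: "(real^'n) set" and \<psi> x
  proof -
    interpret sphere_immersion U "X \<circ> \<psi>"
      using that(1) sph by (rule local_parametrization_sphere_immersion)
    have H: "mean_curvature_vector (X \<circ> \<psi>) x = - ?n *\<^sub>R X (\<psi> x)"
      using sphere_mean_curvature_vector_eq[OF that(2)] min[OF that]
      by (simp add: eq_neg_iff_add_eq_0)
    have "norm (X (\<psi> x)) = 1" using norm_immersion[OF that(2)] by simp
    \<comment> \<open>With n the dimension, the mean curvature vector has norm n, so it is nonzero,
      and minus its quotient by n squared is the position vector divided by n; the position vector
      is its own normal component.\<close>
    then show ?thesis
      using normal_component_immersion[OF that(2)]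
      by (auto simp: H power2_eq_square)
  qed
  then have "imcf_homothetic_soliton TYPE('n) (1 / ?n) M X"
    using sub by (auto simp: imcf_homothetic_soliton_def)
  \<comment> \<open>Positivity holds because a finite index type has at least one element.\<close>
  moreover have "1 / ?n > 0" by simp
  ultimately show ?thesis unfolding imcf_expander_def by blast
qed

end
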